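(* Let $G=(X,Y,E)$ be a 2-layer network in which every vertex of $Y$ has degree at least $1$, and let $<_X$ be a linear order of $X$ such that the one-sided local crossing number of $(G,<_X)$ is $k$. Then every order $<_{\mathsf A}$ of $Y$ that can be returned by heuristic $\mathsf A$ (defined in the context) yields a 2-layer drawing $(<_X,<_{\mathsf A})$ whose local crossing number is at most $3k$.
   Context: A 2-layer network $(X,Y,E)$ is a finite bipartite graph with vertex set $X\cup Y$, $X\cap Y=\emptyset$, edges written $(x,y)$ with $x\in X,y\in Y$. A 2-layer drawing is a pair $(<_X,<_Y)$ of linear orders of $X$ and $Y$; edges $(x_1,y_1),(x_2,y_2)$ cross iff $(x_1<_X x_2\wedge y_2<_Y y_1)$ or $(x_2<_X x_1\wedge y_1<_Y y_2)$. The local crossing number of a drawing is the minimum $k$ such that every edge crosses at most $k$ edges. The one-sided local crossing number of $(G,<_X)$ is the minimum over all linear orders $<_Y$ of $Y$ of the local crossing number of $(<_X,<_Y)$. Heuristic $\mathsf A$: for each $y\in Y$ list its neighbors in increasing $<_X$ order (1-indexed). The median $\mathrm{med}(y)$ is the 2nd neighbor if $\deg(y)=2$, and the $\lfloor \deg(y)/2\rfloor$-th neighbor if $\deg(y)\neq 2$. Call $y$ a 2-vertex if $\deg(y)=2$, an odd vertex if $\deg(y)$ is odd, and a $4^{\oplus}$-vertex if $\deg(y)$ is even and at least $4$. For a 2-vertex $y$, its heavy neighbor is its neighbor other than $\mathrm{med}(y)$. The bunch of $x\in X$ is $\{y\in Y:\mathrm{med}(y)=x\}$. The output $<_{\mathsf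 A}$ is a linear order of $Y$ with $y_1<_{\mathsf A}y_2$ whenever $\mathrm{med}(y_1)<_X\mathrm{med}(y_2)$, and within each bunch: first the 2-vertices in ascending $<_X$-order of their heavy neighbors (ties broken arbitrarily), then the odd vertices in any order, then the $4^{\oplus}$-vertices in ascending order of degree (ties broken arbitrarily).
   Formalization: For odd degree the median is taken as the ⌈deg/2⌉-th neighbor instead of the ⌊deg/2⌋-th: rounding down is undefined for degree 1, and for degree 3 the bound 3k fails (neighborhoods {x0,x1}, {x1,x2,x3}, {x0,x2}: k ≤ 1 but 4 crossings); even degrees are unchanged. *)

theory Defs
  imports Main
begin

definition two_layer_network :: "'v set \<Rightarrow> 'v set \<Rightarrow> ('v \<times> 'v) set \<Rightarrow> bool" where
  "two_layer_network X Y E \<longleftrightarrow> finite X \<and> finite Y \<and> X \<inter> Y = {} \<and> E \<subseteq> X \<times> Y"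

text \<open>Orders are strict; \<open>(a, b) \<in> r\<close> reads \<open>a < b\<close>. The library predicate
  \<^const>\<open>strict_linear_order_on\<close> does not confine the relation to the carrier, hence
  the extra conjunct.\<close>

definition layer_order :: "'v set \<Rightarrow> ('v \<times> 'v) set \<Rightarrow> bool" where
  "layer_order A r \<longleftrightarrow> strict_linear_order_on A r \<and> r \<subseteq> A \<times> A"

definition edges_cross ::
  "('v \<times> 'v) set \<Rightarrow> ('v \<times> 'v) set \<Rightarrow> 'v \<times> 'v \<Rightarrow> 'v \<times> 'v \<Rightarrow> bool" where
  "edges_cross lX lY e f \<longleftrightarrow>
     (fst e, fst f) \<in> lX \<and> (snd f, snd e) \<in> lY \<or>
     (fst f, fst e) \<in> lX \<and> (snd e, snd f) \<in> lY"

definition local_crossing_number ::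
  "('v \<times> 'v) set \<Rightarrow> ('v \<times> 'v) set \<Rightarrow> ('v \<times> 'v) set \<Rightarrow> nat" where
  "local_crossing_number E lX lY =
     (LEAST k. \<forall>e\<in>E. card {f \<in> E. edges_cross lX lY e f} \<le> k)"

definition one_sided_local_crossing_number ::
  "'v set \<Rightarrow> ('v \<times> 'v) set \<Rightarrow> ('v \<times> 'v) set \<Rightarrow> nat" where
  "one_sided_local_crossing_number Y E lX =
     Min {local_crossing_number E lX lY | lY. layer_order Y lY}"

definition neighbors :: "('v \<times> 'v) set \<Rightarrow> 'v \<Rightarrow> 'v set" where
  "neighbors E y = {x. (x, y) \<in> E}"

definition degree :: "('v \<times> 'v) set \<Rightarrow> 'v \<Rightarrow> nat" where
  "degree E y = card (neighbors E y)"

definition neighbor_list :: "('v \<times> 'v) set \<Rightarrow> ('v \<times> 'v) set \<Rightarrow> 'v \<Rightarrow> 'v list" where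
  "neighbor_list E lX y =
     (THE xs. set xs = neighbors E y \<and> sorted_wrt (\<lambda>a b. (a, b) \<in> lX) xs)"

text \<open>Lists are 0-indexed, so the \<open>i\<close>-th neighbor is at position \<open>i - 1\<close>. For degree
  \<open>d \<noteq> 2\<close> the median is neighbor number \<open>\<lceil>d/2\<rceil> = (d + 1) div 2\<close>: the middle neighbor
  for odd \<open>d\<close>, neighbor number \<open>\<lfloor>d/2\<rfloor> = d/2\<close> for even \<open>d\<close>. Rounding down for odd \<open>d\<close> as
  well would refer to a 0-th neighbor when \<open>d = 1\<close>, and taking the first neighbor for
  \<open>d = 3\<close> would break the bound \<open>3k\<close>: for \<open>x\<^sub>0 < x\<^sub>1 < x\<^sub>2 < x\<^sub>3\<close> and vertices
  \<open>a\<close>, \<open>b\<close>, \<open>c\<close> with neighborhoods \<open>{x\<^sub>0, x\<^sub>1}\<close>, \<open>{x\<^sub>1, x\<^sub>2, x\<^sub>3}\<close>, \<open>{x\<^sub>0, x\<^sub>2}\<close>, the order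
  \<open>a, c, b\<close> has local crossing number 1, but \<open>a, b, c\<close> has 4.\<close>

definition med :: "('v \<times> 'v) set \<Rightarrow> ('v \<times> 'v) set \<Rightarrow> 'v \<Rightarrow> 'v" where
  "med E lX y =
     neighbor_list E lX y ! ((if degree E y = 2 then 2 else (degree E y + 1) div 2) - 1)"

definition two_vertex :: "('v \<times> 'v) set \<Rightarrow> 'v \<Rightarrow> bool" where
  "two_vertex E y \<longleftrightarrow> degree E y = 2"

definition odd_vertex :: "('v \<times> 'v) set \<Rightarrow> 'v \<Rightarrow> bool" where
  "odd_vertex E y \<longleftrightarrow> odd (degree E y)"

definition four_plus_vertex :: "('v \<times> 'v) set \<Rightarrow> 'v \<Rightarrow> bool" where
  "four_plus_vertex E y \<longleftrightarrow> even (degree E y) \<and> 4 \<le> degree E y"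

definition heavy_neighbor :: "('v \<times> 'v) set \<Rightarrow> ('v \<times> 'v) set \<Rightarrow> 'v \<Rightarrow> 'v" where
  "heavy_neighbor E lX y = (THE x. x \<in> neighbors E y \<and> x \<noteq> med E lX y)"

definition bunch :: "'v set \<Rightarrow> ('v \<times> 'v) set \<Rightarrow> ('v \<times> 'v) set \<Rightarrow> 'v \<Rightarrow> 'v set" where
  "bunch Y E lX x = {y \<in> Y. med E lX y = x}"

definition heuristic_A_output ::
  "'v set \<Rightarrow> 'v set \<Rightarrow> ('v \<times> 'v) set \<Rightarrow> ('v \<times> 'v) set \<Rightarrow> ('v \<times> 'v) set \<Rightarrow> bool" where
  "heuristic_A_output X Y E lX lA \<longleftrightarrow>
     layer_order Y lA \<and>
     (\<forall>y1\<in>Y. \<forall>y2\<in>Y. (med E lX y1, med E lX y2) \<in> lX \<longrightarrow> (y1, y2) \<in> lA) \<and>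
     (\<forall>x\<in>X. \<forall>y1\<in>bunch Y E lX x. \<forall>y2\<in>bunch Y E lX x.
        (two_vertex E y1 \<and> two_vertex E y2 \<and>
           (heavy_neighbor E lX y1, heavy_neighbor E lX y2) \<in> lX \<longrightarrow> (y1, y2) \<in> lA) \<and>
        (two_vertex E y1 \<and> (odd_vertex E y2 \<or> four_plus_vertex E y2) \<longrightarrow> (y1, y2) \<in> lA) \<and>
        (odd_vertex E y1 \<and> four_plus_vertex E y2 \<longrightarrow> (y1, y2) \<in> lA) \<and>
        (four_plus_vertex E y1 \<and> four_plus_vertex E y2 \<and> degree E y1 < degree E y2
           \<longrightarrow> (y1, y2) \<in> lA))"

end

theory Submission
  imports Defs
begin

text \<open>
  Fix an optimal order \<open><\<^sub>O\<close> and an edge \<open>e = (x, y)\<close>. An edge that crosses \<open>e\<close> under \<open><\<^sub>A\<close> but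
  not under \<open><\<^sub>O\<close> ends in a vertex \<open>y'\<close> whose position relative to \<open>y\<close> differs in the two orders.
  If \<open>y\<close> precedes \<open>y'\<close> under \<open><\<^sub>A\<close>, then \<open>e\<close> crosses the edges of \<open>y'\<close> to the left of \<open>x\<close> under
  \<open><\<^sub>A\<close>, whereas under \<open><\<^sub>O\<close> every edge \<open>(z, y)\<close> crosses the edges of \<open>y'\<close> to the right of \<open>z\<close>; the
  other case is mirrored. Suppose \<open>x\<close> is at most \<open>med y\<close>. If \<open>y <\<^sub>A y'\<close>, then \<open>med y'\<close> is at least
  \<open>med y\<close>, hence at least \<open>x\<close>, so at most half of the neighbors of \<open>y'\<close> are left of \<open>x\<close> and \<open>e\<close> crosses as
  many edges of \<open>y'\<close> under \<open><\<^sub>O\<close> as under \<open><\<^sub>A\<close>; these and the crossings common to both orders number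
  at most \<open>k\<close>. If \<open>y' <\<^sub>A y\<close>, then \<open>med y'\<close> is at most \<open>med y\<close>, and under \<open><\<^sub>O\<close> an edge \<open>(z, y)\<close> with \<open>z\<close>
  beyond \<open>med y\<close> crosses at least half of all edges of \<open>y'\<close>, so these vertices contribute at
  most \<open>2k\<close>. For \<open>x\<close> beyond \<open>med y\<close> the two roles are exchanged. The order of the bunches (2-vertices, odd
  vertices, \<open>4\<^sup>\<oplus>\<close>-vertices) settles the cases in which medians coincide or no such \<open>z\<close> exists.
\<close>

section \<open>Existence and uniqueness of sorted listings\<close>

lemma ex_sorted_wrt_list:
  assumes "finite A" "strict_linear_order_on B r" "A \<subseteq> B"
  shows "\<exists>xs. set xs = A \<and> sorted_wrt (\<lambda>a b. (a, b) \<in> r) xs"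
  using assms(1,3)
proof (induction "card A" arbitrary: A)
  case 0
  then show ?case by auto
next
  case (Suc n)
  have tr: "trans r" and ir: "irrefl r" and tot: "total_on B r"
    using assms(2) by (auto simp: strict_linear_order_on_def)
  have "acyclic r" using tr ir by (simp add: acyclic_irrefl)
  \<comment> \<open>A finite acyclic relation is well-founded, so \<open>A\<close> has a minimal
    element; totality makes it least, and it becomes the head of the list.\<close>
  then have "wf (r \<inter> A \<times> A)"
    using Suc.prems by (intro finite_acyclic_wf) (auto intro: acyclic_subset)
  moreover have "A \<noteq> {}" using Suc.hyps(2) by auto
  ultimately obtain m where m: "m \<in> A" "\<And>b. (b, m) \<in> r \<inter> A \<times> A \<Longrightarrow> b \<notin> A"
    using wfE_min' by metis
  have least: "(m, b) \<in> r" if "b \<in> A - {m}" for b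
    using m that tot Suc.prems unfolding total_on_def by blast
  have "n = card (A - {m})" "finite (A - {m})" "A - {m} \<subseteq> B"
    using Suc.hyps(2) Suc.prems m(1) by auto
  from Suc.hyps(1)[OF this] obtain xs where
    "set xs = A - {m}" "sorted_wrt (\<lambda>a b. (a, b) \<in> r) xs" by blast
  then have "set (m # xs) = A \<and> sorted_wrt (\<lambda>a b. (a, b) \<in> r) (m # xs)"
    using m(1) least by auto
  then show ?case by blast
qed

text \<open>If the heads differed, each would occur in the tail of the other list, so each would
  precede the other.\<close>

lemma sorted_wrt_list_unique:
  assumes "trans r" "irrefl r"
    and "sorted_wrt (\<lambda>a b. (a, b) \<in> r) xs" "sorted_wrt (\<lambda>a b. (a, b) \<in> r) ys"
    and "set xs = set ys"
  shows "xs = ys"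
  using assms(3-5)
proof (induction xs arbitrary: ys)
  case Nil
  then show ?case by simp
next
  case (Cons x xs)
  then obtain y ys' where ys: "ys = y # ys'" by (cases ys) auto
  have nin: "x \<notin> set xs" "y \<notin> set ys'"
    using Cons.prems ys assms(2) by (auto simp: irrefl_def)
  have "x = y"
  proof (rule ccontr)
    assume "x \<noteq> y"
    then have "(x, y) \<in> r" "(y, x) \<in> r" using Cons.prems ys by auto
    then show False using assms(1,2) by (meson irrefl_def transD)
  qed
  moreover have "set xs = set ys'"
    using Cons.prems(3) nin ys \<open>x = y\<close> by auto
  ultimately show ?case using Cons ys by simp
qed

text \<open>Grouping edges by their endpoint in \<open>T\<close> turns counts of crossing edges into
  sums of \<open>nleft\<close> and \<open>nright\<close>.\<close>

lemma card_edges_into: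
  assumes "finite T" "finite E"
  shows "card {f \<in> E. snd f \<in> T \<and> P (fst f)} = (\<Sum>y\<in>T. card {x \<in> neighbors E y. P x})"
proof -
  have "{f \<in> E. snd f \<in> T \<and> P (fst f)} = prod.swap ` (SIGMA y:T. {x \<in> neighbors E y. P x})"
    by (force simp: neighbors_def)
  moreover have "finite {x \<in> neighbors E y. P x}" for y
    by (rule finite_subset[of _ "fst ` E"]) (use assms in \<open>force simp: neighbors_def\<close>)+
  ultimately show ?thesis
    using assms by (simp add: card_image)
qed

section \<open>Neighbor counts on either side of the median\<close>

locale ordered_network =
  fixes X Y :: "'v set" and E lX :: "('v \<times> 'v) set"
  assumes network: "two_layer_network X Y E"
    and orderX: "layer_order X lX"
    and deg_pos: "\<forall>y\<in>Y. 1 \<le> degree E y"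
begin

definition nleft :: "'v \<Rightarrow> 'v \<Rightarrow> nat" where
  "nleft z y = card {x \<in> neighbors E y. (x, z) \<in> lX}"

definition nright :: "'v \<Rightarrow> 'v \<Rightarrow> nat" where
  "nright z y = card {x \<in> neighbors E y. (z, x) \<in> lX}"

text \<open>The 1-based position of the median in the neighbor list.\<close>

definition med_index :: "'v \<Rightarrow> nat" where
  "med_index y = (if degree E y = 2 then 2 else (degree E y + 1) div 2)"

lemma transX: "(a, b) \<in> lX \<Longrightarrow> (b, c) \<in> lX \<Longrightarrow> (a, c) \<in> lX"
  and irreflX: "(a, a) \<notin> lX"
  and totalX: "a \<in> X \<Longrightarrow> b \<in> X \<Longrightarrow> a \<noteq> b \<Longrightarrow> (a, b) \<in> lX \<or> (b, a) \<in> lX"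
  using orderX unfolding layer_order_def strict_linear_order_on_def total_on_def irrefl_def trans_def
  by blast+

lemma asymX: "(a, b) \<in> lX \<Longrightarrow> (b, a) \<notin> lX"
  using transX irreflX by blast

lemma finite_E: "finite E"
  using network finite_subset[of E "X \<times> Y"] by (simp add: two_layer_network_def)

lemma finite_Y: "finite Y"
  using network by (auto simp: two_layer_network_def)

lemma neighbors_subset: "neighbors E y \<subseteq> X"
  using network by (auto simp: two_layer_network_def neighbors_def)

lemma finite_neighbors: "finite (neighbors E y)"
  using network finite_subset[OF neighbors_subset[of y]] by (simp add: two_layer_network_def)

lemma neighbor_list:
  shows set_neighbor_list: "set (neighbor_list E lX y) = neighbors E y"
    and sorted_neighbor_list: "sorted_wrt (\<lambda>a b. (a, b) \<in> lX) (neighbor_list E lX y)"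
proof -
  have r: "strict_linear_order_on X lX" using orderX by (simp add: layer_order_def)
  have "\<exists>!xs. set xs = neighbors E y \<and> sorted_wrt (\<lambda>a b. (a, b) \<in> lX) xs"
    using ex_sorted_wrt_list[OF finite_neighbors r neighbors_subset]
      sorted_wrt_list_unique[of lX] r unfolding strict_linear_order_on_def by metis
  from theI'[OF this]
  show "set (neighbor_list E lX y) = neighbors E y"
    "sorted_wrt (\<lambda>a b. (a, b) \<in> lX) (neighbor_list E lX y)"
    by (auto simp: neighbor_list_def)
qed

lemma nleft_nright_neighbor:
  assumes "z \<in> neighbors E y"
  shows "nleft z y + nright z y + 1 = degree E y"
proof -
  let ?L = "{x \<in> neighbors E y. (x, z) \<in> lX}" and ?R = "{x \<in> neighbors E y. (z, x) \<in> lX}"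
  have "neighbors E y = insert z (?L \<union> ?R)"
    using assms neighbors_subset[of y] totalX by blast
  then have "degree E y = card (insert z (?L \<union> ?R))" by (simp add: degree_def)
  also have "\<dots> = card (?L \<union> ?R) + 1"
    using finite_neighbors[of y] irreflX by simp
  also have "card (?L \<union> ?R) = nleft z y + nright z y"
    unfolding nleft_def nright_def using finite_neighbors[of y]
    by (intro card_Un_disjoint) (auto dest: asymX)
  finally show ?thesis by simp
qed

lemma nleft_nright_le: "nleft z y + nright z y \<le> degree E y"
proof -
  have "nleft z y + nright z y
      = card ({x \<in> neighbors E y. (x, z) \<in> lX} \<union> {x \<in> neighbors E y. (z, x) \<in> lX})"
    unfolding nleft_def nright_def using finite_neighbors[of y]
    by (subst card_Un_disjoint) (auto dest: asymX)
  also have "\<dots> \<le> degree E y"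
    unfolding degree_def using finite_neighbors by (intro card_mono) auto
  finally show ?thesis .
qed

text \<open>The neighbors before the median form the prefix of length \<open>med_index y - 1\<close>
  of the repetition-free neighbor list.\<close>

lemma med_mem_and_nleft_med:
  assumes "y \<in> Y"
  shows med_mem: "med E lX y \<in> neighbors E y"
    and nleft_med: "nleft (med E lX y) y + 1 = med_index y"
proof -
  define xs where "xs = neighbor_list E lX y"
  define i where "i = med_index y - 1"
  have xs: "set xs = neighbors E y" "sorted_wrt (\<lambda>a b. (a, b) \<in> lX) xs"
    by (simp_all add: xs_def neighbor_list)
  have lt: "(xs ! a, xs ! b) \<in> lX" if "a < b" "b < length xs" for a b
    using xs(2) that by (simp add: sorted_wrt_iff_nth_less)
  have dist: "distinct xs"
    unfolding distinct_conv_nth using lt irreflX by (metis nat_neq_iff)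
  have len: "length xs = degree E y"
    using dist xs(1) by (metis degree_def distinct_card)
  \<comment> \<open>Positive degree makes \<open>med_index y\<close> positive, so the subtraction in
    \<open>i\<close> is not truncated.\<close>
  have pos: "1 \<le> degree E y" using assms deg_pos by simp
  then have i: "i < length xs" "i + 1 = med_index y"
    unfolding i_def len med_index_def by auto
  have m: "med E lX y = xs ! i"
    by (simp add: med_def i_def med_index_def xs_def)
  show "med E lX y \<in> neighbors E y"
    using i m xs(1) by (metis nth_mem)
  have "{x \<in> neighbors E y. (x, xs ! i) \<in> lX} = set (take i xs)"
  proof (intro set_eqI iffI)
    fix x assume "x \<in> {x \<in> neighbors E y. (x, xs ! i) \<in> lX}"
    then obtain j where j: "j < length xs" "x = xs ! j" "(xs ! j, xs ! i) \<in> lX"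
      using xs(1) by (metis (no_types, lifting) in_set_conv_nth mem_Collect_eq)
    then have "j < i" using lt i irreflX transX by (metis nat_neq_iff)
    then show "x \<in> set (take i xs)" using j i by (auto simp: in_set_conv_nth)
  next
    fix x assume x: "x \<in> set (take i xs)"
    then have "x \<in> neighbors E y" using xs(1) by (metis in_set_takeD)
    moreover have "(x, xs ! i) \<in> lX" using x i lt by (auto simp: in_set_conv_nth)
    ultimately show "x \<in> {x \<in> neighbors E y. (x, xs ! i) \<in> lX}" by simp
  qed
  then show "nleft (med E lX y) y + 1 = med_index y"
    using i dist by (simp add: nleft_def m distinct_card)
qed

lemma nright_med: "y \<in> Y \<Longrightarrow> nright (med E lX y) y + med_index y = degree E y"
  using nleft_nright_neighbor[OF med_mem[of y]] nleft_med[of y] by simp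

text \<open>Besides the \<open>degree E y - med_index y\<close> neighbors right of the median, the
  median itself now counts.\<close>

lemma nright_before_med:
  assumes "y \<in> Y" "(z, med E lX y) \<in> lX"
  shows "degree E y + 1 \<le> nright z y + med_index y"
proof -
  have "insert (med E lX y) {x \<in> neighbors E y. (med E lX y, x) \<in> lX}
      \<subseteq> {x \<in> neighbors E y. (z, x) \<in> lX}"
    using assms med_mem transX by auto
  from card_mono[OF _ this] have "nright (med E lX y) y + 1 \<le> nright z y"
    using finite_neighbors by (simp add: nright_def irreflX)
  then show ?thesis using nright_med[OF assms(1)] by simp
qed

lemma nleft_after_med:
  assumes "y \<in> Y" "(med E lX y, z) \<in> lX"
  shows "med_index y \<le> nleft z y"
proof -
  have "insert (med E lX y) {x \<in> neighbors E y. (x, med E lX y) \<in> lX}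
      \<subseteq> {x \<in> neighbors E y. (x, z) \<in> lX}"
    using assms med_mem transX by auto
  from card_mono[OF _ this] have "nleft (med E lX y) y + 1 \<le> nleft z y"
    using finite_neighbors by (simp add: nleft_def irreflX)
  then show ?thesis using nleft_med[OF assms(1)] by simp
qed

lemma ex_neighbor_before_med:
  assumes "y \<in> Y" "2 \<le> degree E y"
  obtains z where "z \<in> neighbors E y" "(z, med E lX y) \<in> lX"
proof -
  have "nleft (med E lX y) y \<noteq> 0"
    using nleft_med[OF assms(1)] assms(2) by (auto simp: med_index_def split: if_splits)
  then have "{x \<in> neighbors E y. (x, med E lX y) \<in> lX} \<noteq> {}"
    unfolding nleft_def by (metis card.empty)
  then show ?thesis using that by blast
qed

lemma ex_neighbor_after_med:
  assumes "y \<in> Y" "3 \<le> degree E y"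
  obtains z where "z \<in> neighbors E y" "(med E lX y, z) \<in> lX"
proof -
  have "nright (med E lX y) y \<noteq> 0"
    using nright_med[OF assms(1)] assms(2) by (auto simp: med_index_def)
  then have "{x \<in> neighbors E y. (med E lX y, x) \<in> lX} \<noteq> {}"
    unfolding nright_def by (metis card.empty)
  then show ?thesis using that by blast
qed

text \<open>The slack 2 in the last bound is attained only at degree 2, where the median is the last
  neighbor; for other degrees \<open>d\<close>, twice the index is \<open>d\<close> or
  \<open>d + 1\<close>.\<close>

lemma med_index_bounds:
  assumes "y \<in> Y"
  shows "1 \<le> med_index y" "degree E y \<le> 2 * med_index y" "2 * med_index y \<le> degree E y + 2"
  using deg_pos assms by (auto simp: med_index_def)

end

section \<open>Crossing numbers as attained bounds\<close>

lemma local_crossing_number_le_iff: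
  assumes "finite E"
  shows "local_crossing_number E lX lY \<le> k \<longleftrightarrow>
    (\<forall>e\<in>E. card {f \<in> E. edges_cross lX lY e f} \<le> k)"
proof
  have "\<exists>k. \<forall>e\<in>E. card {f \<in> E. edges_cross lX lY e f} \<le> k"
    using assms by (intro exI[of _ "card E"]) (auto intro: card_mono)
  from LeastI_ex[OF this]
  have "\<forall>e\<in>E. card {f \<in> E. edges_cross lX lY e f} \<le> local_crossing_number E lX lY"
    unfolding local_crossing_number_def .
  then show "local_crossing_number E lX lY \<le> k \<Longrightarrow>
      \<forall>e\<in>E. card {f \<in> E. edges_cross lX lY e f} \<le> k"
    using le_trans by blast
qed (simp add: local_crossing_number_def Least_le)

lemma one_sided_local_crossing_number_attained:
  assumes "finite Y" "layer_order Y lY"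
  obtains lO where "layer_order Y lO"
    "local_crossing_number E lX lO = one_sided_local_crossing_number Y E lX"
proof -
  let ?S = "{local_crossing_number E lX lY | lY. layer_order Y lY}"
  have "?S \<subseteq> local_crossing_number E lX ` Pow (Y \<times> Y)"
    by (auto simp: layer_order_def)
  then have "finite ?S" using assms(1) by (meson finite_Pow_iff finite_SigmaI finite_imageI finite_subset)
  moreover have "?S \<noteq> {}" using assms(2) by auto
  ultimately have "Min ?S \<in> ?S" by (rule Min_in)
  then show ?thesis using that unfolding one_sided_local_crossing_number_def by auto
qed

section \<open>The heuristic and an optimal order around a fixed vertex\<close>

locale heuristic_vs_optimum = ordered_network X Y E lX
  for X Y :: "'v set" and E lX :: "('v \<times> 'v) set" +
  fixes lA lO :: "('v \<times> 'v) set" and k :: nat and y :: 'v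
  assumes heuristic: "heuristic_A_output X Y E lX lA"
    and orderO: "layer_order Y lO"
    and optimum: "\<And>e. e \<in> E \<Longrightarrow> card {f \<in> E. edges_cross lX lO e f} \<le> k"
    and y_in: "y \<in> Y"
begin

text \<open>Only edges ending in \<open>up\<close> or \<open>down\<close> can change their crossing
  status with edges of \<open>y\<close> between \<open>lO\<close> and \<open>lA\<close>.\<close>

definition up :: "'v set" where
  "up = {y' \<in> Y. (y, y') \<in> lA \<and> (y', y) \<in> lO}"

definition down :: "'v set" where
  "down = {y' \<in> Y. (y', y) \<in> lA \<and> (y, y') \<in> lO}"

lemma orderA: "layer_order Y lA"
  using heuristic by (simp add: heuristic_A_output_def)

lemma asymA: "(a, b) \<in> lA \<Longrightarrow> (b, a) \<notin> lA" and subA: "(a, b) \<in> lA \<Longrightarrow> a \<in> Y \<and> b \<in> Y"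
  using orderA unfolding layer_order_def strict_linear_order_on_def irrefl_def trans_def
  by blast+

lemma totalO: "a \<in> Y \<Longrightarrow> b \<in> Y \<Longrightarrow> a \<noteq> b \<Longrightarrow> (a, b) \<in> lO \<or> (b, a) \<in> lO"
  using orderO unfolding layer_order_def strict_linear_order_on_def total_on_def by blast

lemma irreflA: "(a, a) \<notin> lA"
  using asymA by blast

lemma finite_up: "finite up" and finite_down: "finite down"
  using finite_Y by (simp_all add: up_def down_def)

lemma up_sum_right: "card {f \<in> E. snd f \<in> up \<and> (z, fst f) \<in> lX} = (\<Sum>y'\<in>up. nright z y')"
  and up_sum_left: "card {f \<in> E. snd f \<in> up \<and> (fst f, z) \<in> lX} = (\<Sum>y'\<in>up. nleft z y')"
  and down_sum_right: "card {f \<in> E. snd f \<in> down \<and> (z, fst f) \<in> lX} = (\<Sum>y'\<in>down. nright z y')"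
  and down_sum_left: "card {f \<in> E. snd f \<in> down \<and> (fst f, z) \<in> lX} = (\<Sum>y'\<in>down. nleft z y')"
  unfolding nleft_def nright_def
  by (rule card_edges_into[OF finite_up finite_E] card_edges_into[OF finite_down finite_E])+

definition common :: "'v \<Rightarrow> nat" where
  "common x = card {f \<in> E. edges_cross lX lA (x, y) f \<and> edges_cross lX lO (x, y) f}"

lemma crossings_heuristic:
  "card {f \<in> E. edges_cross lX lA (x, y) f}
    \<le> common x + (\<Sum>y'\<in>up. nleft x y') + (\<Sum>y'\<in>down. nright x y')"
proof -
  let ?C = "{f \<in> E. edges_cross lX lA (x, y) f \<and> edges_cross lX lO (x, y) f}"
  let ?U = "{f \<in> E. snd f \<in> up \<and> (fst f, x) \<in> lX}"
  let ?D = "{f \<in> E. snd f \<in> down \<and> (x, fst f) \<in> lX}"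
  have "{f \<in> E. edges_cross lX lA (x, y) f} \<subseteq> ?C \<union> ?U \<union> ?D"
  proof
    fix f assume f: "f \<in> {f \<in> E. edges_cross lX lA (x, y) f}"
    then have "snd f \<in> Y" "snd f \<noteq> y"
      using subA irreflA by (auto simp: edges_cross_def)
    then have "(y, snd f) \<in> lO \<or> (snd f, y) \<in> lO" using totalO y_in by blast
    then show "f \<in> ?C \<union> ?U \<union> ?D"
      using f \<open>snd f \<in> Y\<close> by (auto simp: edges_cross_def up_def down_def)
  qed
  then have "card {f \<in> E. edges_cross lX lA (x, y) f} \<le> card (?C \<union> ?U \<union> ?D)"
    using finite_E by (intro card_mono) auto
  also have "\<dots> \<le> card ?C + card ?U + card ?D"
    by (meson card_Un_le add_le_mono le_refl le_trans)
  finally show ?thesis by (simp add: common_def up_sum_left down_sum_right)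
qed

text \<open>Used twice per edge: at \<open>x\<close> it pays for the common crossings and one
  reversed class, at another suitable neighbor \<open>z\<close> for the other class.\<close>

lemma crossings_optimum:
  assumes "x \<in> neighbors E y"
  shows "common x + (\<Sum>y'\<in>up. nright x y') + (\<Sum>y'\<in>down. nleft x y') \<le> k"
proof -
  let ?C = "{f \<in> E. edges_cross lX lA (x, y) f \<and> edges_cross lX lO (x, y) f}"
  let ?U = "{f \<in> E. snd f \<in> up \<and> (x, fst f) \<in> lX}"
  let ?D = "{f \<in> E. snd f \<in> down \<and> (fst f, x) \<in> lX}"
  have fin: "finite ?C" "finite ?U" "finite ?D" using finite_E by auto
  \<comment> \<open>Edges in \<open>?U\<close> and \<open>?D\<close> do not cross
    \<open>(x, y)\<close> under \<open>lA\<close>, and \<open>up\<close> and \<open>down\<close> are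
    disjoint.\<close>
  have disj: "?C \<inter> ?U = {}" "(?C \<union> ?U) \<inter> ?D = {}"
    using asymA asymX unfolding edges_cross_def up_def down_def by auto
  have "card ?C + card ?U + card ?D = card (?C \<union> ?U \<union> ?D)"
    using fin disj by (simp add: card_Un_disjoint)
  also have "\<dots> \<le> card {f \<in> E. edges_cross lX lO (x, y) f}"
    using finite_E by (intro card_mono) (auto simp: edges_cross_def up_def down_def)
  also have "\<dots> \<le> k" using optimum assms by (simp add: neighbors_def)
  finally show ?thesis by (simp add: common_def up_sum_right down_sum_left)
qed

lemma up_D:
  assumes "y' \<in> up"
  shows "y' \<in> Y" "(y, y') \<in> lA" "med E lX y = med E lX y' \<or> (med E lX y, med E lX y') \<in> lX"
proof -
  show y': "y' \<in> Y" "(y, y') \<in> lA" using assms by (auto simp: up_def)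
  have "(med E lX y', med E lX y) \<notin> lX"
    using heuristic asymA y' y_in unfolding heuristic_A_output_def by blast
  then show "med E lX y = med E lX y' \<or> (med E lX y, med E lX y') \<in> lX"
    using totalX med_mem neighbors_subset y' y_in by blast
qed

lemma down_D:
  assumes "y' \<in> down"
  shows "y' \<in> Y" "(y', y) \<in> lA" "med E lX y' = med E lX y \<or> (med E lX y', med E lX y) \<in> lX"
proof -
  show y': "y' \<in> Y" "(y', y) \<in> lA" using assms by (auto simp: down_def)
  have "(med E lX y, med E lX y') \<notin> lX"
    using heuristic asymA y' y_in unfolding heuristic_A_output_def by blast
  then show "med E lX y' = med E lX y \<or> (med E lX y', med E lX y) \<in> lX"
    using totalX med_mem neighbors_subset y' y_in by blast
qed

text \<open>Otherwise \<open>b\<close> would have an earlier type than \<open>a\<close>, and the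
  heuristic would place it first. This settles the cases of equal medians.\<close>

lemma bunch_order:
  assumes "(a, b) \<in> lA" "med E lX a = med E lX b"
  shows "degree E b = 2 \<Longrightarrow> degree E a = 2"
    and "odd (degree E b) \<Longrightarrow> degree E a = 2 \<or> odd (degree E a)"
proof -
  have ab: "a \<in> Y" "b \<in> Y" using subA assms by auto
  have mX: "med E lX a \<in> X" using med_mem neighbors_subset ab by blast
  have in_bunch: "a \<in> bunch Y E lX (med E lX a)" "b \<in> bunch Y E lX (med E lX a)"
    using ab assms by (auto simp: bunch_def)
  have types: "two_vertex E a \<or> odd_vertex E a \<or> four_plus_vertex E a"
  proof -
    have "degree E a = 2 \<or> odd (degree E a) \<or> even (degree E a) \<and> 4 \<le> degree E a"
      using deg_pos ab by (cases "degree E a \<le> 3") (auto simp: le_Suc_eq numeral_3_eq_3)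
    then show ?thesis
      by (simp add: two_vertex_def odd_vertex_def four_plus_vertex_def)
  qed
  have not_ba: "(b, a) \<notin> lA" using asymA assms by blast
  show "degree E b = 2 \<Longrightarrow> degree E a = 2"
    using heuristic mX in_bunch types not_ba
    unfolding heuristic_A_output_def two_vertex_def by blast
  show "odd (degree E b) \<Longrightarrow> degree E a = 2 \<or> odd (degree E a)"
    using heuristic mX in_bunch types not_ba
    unfolding heuristic_A_output_def two_vertex_def odd_vertex_def by blast
qed

section \<open>The bound \<open>3 * k\<close>, by the position of the edge relative to the
  median\<close>

lemma crossings_after_median:
  assumes x: "x \<in> neighbors E y" and after: "(med E lX y, x) \<in> lX"
  shows "card {f \<in> E. edges_cross lX lA (x, y) f} \<le> 3 * k"
proof -
  have "{z \<in> neighbors E y. (med E lX y, z) \<in> lX} \<noteq> {}" using x after by blast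
  then have "nright (med E lX y) y \<noteq> 0"
    unfolding nright_def using finite_neighbors by simp
  then have "degree E y \<ge> 2"
    using nright_med[OF y_in] med_index_bounds[OF y_in] by linarith
  then obtain z where z: "z \<in> neighbors E y" "(z, med E lX y) \<in> lX"
    using ex_neighbor_before_med y_in by blast
  have "nright x y' \<le> nleft x y'" if "y' \<in> down" for y'
  proof -
    have "(med E lX y', x) \<in> lX" using down_D[OF that] after transX by metis
    then show ?thesis
      using nleft_after_med[of y' x] nleft_nright_le[of x y'] med_index_bounds[of y'] down_D[OF that]
      by linarith
  qed
  then have D: "(\<Sum>y'\<in>down. nright x y') \<le> (\<Sum>y'\<in>down. nleft x y')" by (rule sum_mono)
  \<comment> \<open>\<open>z\<close> lies strictly before the median of \<open>y'\<close>, so at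
    least half of the neighbors of \<open>y'\<close> are right of \<open>z\<close>; the slack 2 in
    \<open>med_index_bounds\<close> just suffices.\<close>
  have "nleft x y' \<le> 2 * nright z y'" if "y' \<in> up" for y'
  proof -
    have "(z, med E lX y') \<in> lX" using up_D[OF that] z transX by metis
    then show ?thesis
      using nright_before_med[of y' z] nleft_nright_le[of x y'] med_index_bounds[of y'] up_D[OF that]
      by linarith
  qed
  then have U: "(\<Sum>y'\<in>up. nleft x y') \<le> 2 * (\<Sum>y'\<in>up. nright z y')"
    unfolding sum_distrib_left by (rule sum_mono)
  \<comment> \<open>The optimum at \<open>x\<close> contributes \<open>k\<close>, and twice the
    optimum at \<open>z\<close> contributes \<open>2 * k\<close>.\<close>
  show ?thesis
    using D U crossings_heuristic[of x] crossings_optimum[OF x] crossings_optimum[OF z(1)] by linarith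
qed

text \<open>The median of a 2-vertex is its last neighbor, so its edge is treated like one beyond
  the median, with the first neighbor as \<open>z\<close>.\<close>

lemma crossings_median_of_two_vertex:
  assumes "degree E y = 2"
  shows "card {f \<in> E. edges_cross lX lA (med E lX y, y) f} \<le> 3 * k"
proof -
  let ?x = "med E lX y"
  obtain z where z: "z \<in> neighbors E y" "(z, ?x) \<in> lX"
    using ex_neighbor_before_med[OF y_in] assms by (metis order_refl)
  have "nright ?x y' \<le> nleft ?x y'" if "y' \<in> down" for y'
    using down_D(3)[OF that]
  proof
    \<comment> \<open>Here \<open>y'\<close> is also a 2-vertex, so it has no neighbor right of
      \<open>?x\<close>.\<close>
    assume eq: "med E lX y' = ?x"
    then have "degree E y' = 2" using bunch_order(1) down_D[OF that] assms by blast
    then show ?thesis using nright_med[of y'] down_D[OF that] eq by (simp add: med_index_def)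
  next
    assume "(med E lX y', ?x) \<in> lX"
    then show ?thesis
      using nleft_after_med[of y' ?x] nleft_nright_le[of ?x y'] med_index_bounds[of y'] down_D[OF that]
      by linarith
  qed
  then have D: "(\<Sum>y'\<in>down. nright ?x y') \<le> (\<Sum>y'\<in>down. nleft ?x y')" by (rule sum_mono)
  have "nleft ?x y' \<le> 2 * nright z y'" if "y' \<in> up" for y'
  proof -
    have "(z, med E lX y') \<in> lX" using up_D[OF that] z transX by metis
    then show ?thesis
      using nright_before_med[of y' z] nleft_nright_le[of ?x y'] med_index_bounds[of y'] up_D[OF that]
      by linarith
  qed
  then have U: "(\<Sum>y'\<in>up. nleft ?x y') \<le> 2 * (\<Sum>y'\<in>up. nright z y')"
    unfolding sum_distrib_left by (rule sum_mono)
  show ?thesis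
    using D U crossings_heuristic[of ?x] crossings_optimum[OF med_mem[OF y_in]]
      crossings_optimum[OF z(1)] by linarith
qed

lemma crossings_up_to_median:
  assumes x: "x \<in> neighbors E y" and before: "x = med E lX y \<or> (x, med E lX y) \<in> lX"
    and not_two: "degree E y = 2 \<Longrightarrow> x \<noteq> med E lX y"
  shows "card {f \<in> E. edges_cross lX lA (x, y) f} \<le> 3 * k"
proof -
  have "nleft x y' \<le> nright x y'" if "y' \<in> up" for y'
  proof (cases "x = med E lX y'")
    case True
    then have eq: "med E lX y = med E lX y'"
      using up_D(3)[OF that] before asymX by metis
    \<comment> \<open>A 2-vertex \<open>y'\<close> in the same bunch after \<open>y\<close> would
      make \<open>y\<close> a 2-vertex with \<open>x\<close> as its median, which
      \<open>not_two\<close> excludes.\<close>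
    then have "degree E y' \<noteq> 2"
      using bunch_order(1)[OF up_D(2)[OF that]] True not_two by metis
    then have "2 * med_index y' \<le> degree E y' + 1" by (simp add: med_index_def)
    then show ?thesis
      using True nleft_med[of y'] nright_med[of y'] up_D(1)[OF that] by simp
  next
    case False
    then have "(x, med E lX y') \<in> lX"
      using up_D(3)[OF that] before transX by metis
    then show ?thesis
      using nright_before_med[of y' x] nleft_nright_le[of x y'] med_index_bounds[of y'] up_D[OF that]
        nleft_nright_le
      by linarith
  qed
  then have U: "(\<Sum>y'\<in>up. nleft x y') \<le> (\<Sum>y'\<in>up. nright x y')" by (rule sum_mono)
  \<comment> \<open>The witness is a neighbor beyond the median if the degree is at least 3, the
    median itself at degree 2, and the only neighbor \<open>x\<close> at degree 1.\<close>
  obtain z where z: "z \<in> neighbors E y" and half: "\<And>y'. y' \<in> down \<Longrightarrow> nright x y' \<le> 2 * nleft z y'"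
  proof -
    consider "3 \<le> degree E y" | "degree E y = 2" | "degree E y = 1"
      using deg_pos y_in by fastforce
    then show ?thesis
    proof cases
      case 1
      then obtain z where z: "z \<in> neighbors E y" "(med E lX y, z) \<in> lX"
        using ex_neighbor_after_med y_in by blast
      show ?thesis
      proof (rule that[OF z(1)])
        fix y' assume y': "y' \<in> down"
        have "(med E lX y', z) \<in> lX" using down_D[OF y'] z transX by metis
        then show "nright x y' \<le> 2 * nleft z y'"
          using nleft_after_med[of y' z] nleft_nright_le[of x y'] med_index_bounds[of y'] down_D[OF y']
          by linarith
      qed
    next
      case 2
      show ?thesis
      proof (rule that[OF med_mem[OF y_in]])
        fix y' assume y': "y' \<in> down"
        from down_D(3)[OF y'] show "nright x y' \<le> 2 * nleft (med E lX y) y'"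
        proof
          assume eq: "med E lX y' = med E lX y"
          then have d: "degree E y' = 2" using bunch_order(1) down_D[OF y'] 2 by blast
          then have "nleft (med E lX y) y' = 1"
            using nleft_med[OF down_D(1)[OF y']] eq by (simp add: med_index_def)
          then show ?thesis using nleft_nright_le[of x y'] d by simp
        next
          assume "(med E lX y', med E lX y) \<in> lX"
          then show ?thesis
            using nleft_after_med[of y' "med E lX y"] nleft_nright_le[of x y'] med_index_bounds[of y']
              down_D[OF y'] by linarith
        qed
      qed
    next
      case 3
      then have xm: "x = med E lX y"
        using x med_mem[OF y_in] unfolding degree_def by (auto simp: card_1_singleton_iff)
      show ?thesis
      proof (rule that[OF x])
        fix y' assume y': "y' \<in> down"
        from down_D(3)[OF y'] show "nright x y' \<le> 2 * nleft x y'"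
        proof
          assume eq: "med E lX y' = med E lX y"
          \<comment> \<open>For these degrees, at least as many neighbors of \<open>y'\<close> lie
            left of its median as right of it.\<close>
          then have "degree E y' = 2 \<or> odd (degree E y')"
            using bunch_order(2)[OF down_D(2)[OF y'] eq] 3 by simp
          then have "degree E y' + 1 \<le> 2 * med_index y'" by (auto simp: med_index_def)
          then show ?thesis
            using nleft_med[OF down_D(1)[OF y']] nright_med[OF down_D(1)[OF y']] eq xm by simp
        next
          assume "(med E lX y', med E lX y) \<in> lX"
          then show ?thesis
            using nleft_after_med[of y' x] nleft_nright_le[of x y'] med_index_bounds[of y']
              down_D[OF y'] xm by simp
        qed
      qed
    qed
  qed
  have "(\<Sum>y'\<in>down. nright x y') \<le> 2 * (\<Sum>y'\<in>down. nleft z y')"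
    unfolding sum_distrib_left using half by (rule sum_mono)
  then show ?thesis
    using U crossings_heuristic[of x] crossings_optimum[OF x] crossings_optimum[OF z] by linarith
qed

lemma crossings_le:
  assumes "x \<in> neighbors E y"
  shows "card {f \<in> E. edges_cross lX lA (x, y) f} \<le> 3 * k"
proof -
  have "x = med E lX y \<or> (x, med E lX y) \<in> lX \<or> (med E lX y, x) \<in> lX"
    using totalX assms med_mem[OF y_in] neighbors_subset[of y] by blast
  then show ?thesis
    using crossings_after_median[OF assms] crossings_median_of_two_vertex
      crossings_up_to_median[OF assms] by metis
qed

end

theorem theorem2:
  fixes X Y :: "'v set" and E lX lA :: "('v \<times> 'v) set" and k :: nat
  assumes "two_layer_network X Y E"
    and "\<forall>y\<in>Y. 1 \<le> degree E y"
    and "layer_order X lX"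
    and "one_sided_local_crossing_number Y E lX = k"
    and "heuristic_A_output X Y E lX lA"
  shows "local_crossing_number E lX lA \<le> 3 * k"
proof -
  interpret ordered_network X Y E lX
    using assms by unfold_locales
  \<comment> \<open>\<open>lA\<close> itself shows that the set under \<open>Min\<close> is
    nonempty, so an optimal order exists.\<close>
  have "layer_order Y lA" using assms(5) by (simp add: heuristic_A_output_def)
  then obtain lO where lO: "layer_order Y lO" "local_crossing_number E lX lO = k"
    using one_sided_local_crossing_number_attained finite_Y assms(4) by metis
  have opt: "\<And>e. e \<in> E \<Longrightarrow> card {f \<in> E. edges_cross lX lO e f} \<le> k"
    using local_crossing_number_le_iff[OF finite_E, of lX lO k] lO(2) by simp
  have "card {f \<in> E. edges_cross lX lA (x, y) f} \<le> 3 * k" if "(x, y) \<in> E" for x y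
  proof -
    have "y \<in> Y" using that network by (auto simp: two_layer_network_def)
    then interpret heuristic_vs_optimum X Y E lX lA lO k y
      using assms(5) lO(1) opt by unfold_locales
    show ?thesis using crossings_le that by (simp add: neighbors_def)
  qed
  then show ?thesis
    by (simp add: local_crossing_number_le_iff[OF finite_E] split_paired_all)
qed

end
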